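(* Let $\Gamma$ be a finite graph (parallel edges allowed, no loops or semi-edges). If $L$ is a corneration of $\Gamma$, then $\mathbb{C}(L)$ is a circuit decomposition of $\Gamma$. Conversely, if $\mathcal{C}$ is a circuit decomposition of $\Gamma$, then the set $L(\mathcal{C})$ of all $\mathcal{C}$-corners is a corneration $L$ of $\Gamma$ such that $\mathcal{C} = \mathbb{C}(L)$.
   Context: A graph is a triple $(V,E,\partial)$ with $V$ (vertices), $E$ (edges) finite and disjoint, and $\partial$ assigning to each edge a set of two distinct end-vertices (parallel edges are allowed). A dart is a pair $\{v,e\}$ with $e\in E$, $v\in\partial(e)$. A corner is a set $\{e_1,v,e_2\}$ with $e_1\ne e_2$ edges and $v\in\partial(e_1)\cap\partial(e_2)$; it contains the two darts $\{e_1,v\}$ and $\{v,e_2\}$. A corneration of $\Gamma$ is a set $L$ of corners such that every dart of $\Gamma$ is contained in exactly one corner of $L$. A closed walk of length $k$ is a sequence $[v_0,e_0,v_1,e_1,\dots,v_{k-1},e_{k-1},v_k=v_0]$ with $\partial(e_i)=\{v_i,v_{i+1}\}$. A circuit is a closed walk of length $k\ge 1$ with $k$ distinct edges (vertices may repeat), considered as undirected and unrooted (i.e. up to cyclic shift and reversal). A circuit decomposition of $\Gamma$ is a set of circuits such that every edge of $\Gamma$ lies in exactly one of them. For a circuit decomposition $\mathcal{C}$, a $\mathcal{C}$-corner is a corner $\{e,v,e'\}$ such that $e,v,e'$ is a (cyclically) consecutive triple in some circuit of $\mathcal{C}$. Given a corneration $L$ and a dart $d_0=\{e_0,v_0\}$,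 there is a unique edge $e_1$ with $\{e_0,v_0,e_1\}\in L$; let $v_1$ be the end-vertex of $e_1$ other than $v_0$. The dart $d_1=\{e_1,v_1\}$ is called the predecessor of $d_0$. Let $d_{i+1}$ be the predecessor of $d_i$ for all $i\ge0$, write $d_i=\{e_i,v_i\}$, and let $k>0$ be smallest with $d_k=d_0$. Let $O(d_0)$ be the circuit traversing the edges $e_0,e_1,\dots,e_{k-1}$ cyclically, passing from $e_i$ to $e_{i+1}$ through $v_i$. Then $\mathbb{C}(L)$ is the set of all $O(d)$, where $d$ ranges over the darts of $\Gamma$. *)

theory Defs
  imports Main
begin

text \<open>Vertices and edges live in one type, so that darts and corners are literally the sets
  \<open>{v, e}\<close> and \<open>{e\<^sub>1, v, e\<^sub>2}\<close>.\<close>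

record 'a multigraph =
  verts :: "'a set"
  edges :: "'a set"
  ends :: "'a \<Rightarrow> 'a set"

definition graph :: "'a multigraph \<Rightarrow> bool" where
  "graph G \<longleftrightarrow> finite (verts G) \<and> finite (edges G) \<and> verts G \<inter> edges G = {} \<and>
     (\<forall>e\<in>edges G. ends G e \<subseteq> verts G \<and> card (ends G e) = 2)"

definition darts :: "'a multigraph \<Rightarrow> 'a set set" where
  "darts G = {{v, e} | v e. e \<in> edges G \<and> v \<in> ends G e}"

definition corners :: "'a multigraph \<Rightarrow> 'a set set" where
  "corners G = {{e1, v, e2} | e1 v e2.
     e1 \<in> edges G \<and> e2 \<in> edges G \<and> e1 \<noteq> e2 \<and> v \<in> ends G e1 \<inter> ends G e2}"

definition corneration :: "'a multigraph \<Rightarrow> 'a set set \<Rightarrow> bool" where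
  "corneration G L \<longleftrightarrow> L \<subseteq> corners G \<and> (\<forall>d\<in>darts G. \<exists>!c. c \<in> L \<and> d \<subseteq> c)"

text \<open>The list \<open>[(v\<^sub>0, e\<^sub>0), \<dots>, (v\<^sub>k\<^sub>-\<^sub>1, e\<^sub>k\<^sub>-\<^sub>1)]\<close> stands for the closed walk
  \<open>[v\<^sub>0, e\<^sub>0, \<dots>, v\<^sub>k\<^sub>-\<^sub>1, e\<^sub>k\<^sub>-\<^sub>1, v\<^sub>k = v\<^sub>0]\<close>; the repeated last vertex is not stored.\<close>

definition closed_walk :: "'a multigraph \<Rightarrow> ('a \<times> 'a) list \<Rightarrow> bool" where
  "closed_walk G w \<longleftrightarrow> (\<forall>i<length w. fst (w ! i) \<in> verts G \<and> snd (w ! i) \<in> edges G \<and>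
     ends G (snd (w ! i)) = {fst (w ! i), fst (w ! (Suc i mod length w))})"

text \<open>The reversed walk \<open>[v\<^sub>0, e\<^sub>k\<^sub>-\<^sub>1, v\<^sub>k\<^sub>-\<^sub>1, \<dots>, v\<^sub>1, e\<^sub>0, v\<^sub>0]\<close>; the rotation of the vertex
  list keeps the root \<open>v\<^sub>0\<close>.\<close>

definition reverse_walk :: "('a \<times> 'a) list \<Rightarrow> ('a \<times> 'a) list" where
  "reverse_walk w = zip (rev (rotate1 (map fst w))) (rev (map snd w))"

text \<open>A circuit is the set of all closed walks obtained from one of them by cyclic shifts and
  reversal.\<close>

definition unrooted :: "('a \<times> 'a) list \<Rightarrow> ('a \<times> 'a) list set" where
  "unrooted w = {rotate n w | n. True} \<union> {rotate n (reverse_walk w) | n. True}"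

definition circuits :: "'a multigraph \<Rightarrow> ('a \<times> 'a) list set set" where
  "circuits G = {unrooted w | w. closed_walk G w \<and> length w \<ge> 1 \<and> distinct (map snd w)}"

definition circuit_edges :: "('a \<times> 'a) list set \<Rightarrow> 'a set" where
  "circuit_edges C = (\<Union>w\<in>C. set (map snd w))"

definition circuit_decomposition :: "'a multigraph \<Rightarrow> ('a \<times> 'a) list set set \<Rightarrow> bool" where
  "circuit_decomposition G \<C> \<longleftrightarrow> \<C> \<subseteq> circuits G \<and>
     (\<forall>e\<in>edges G. \<exists>!C. C \<in> \<C> \<and> e \<in> circuit_edges C)"

definition consecutive :: "('a \<times> 'a) list set \<Rightarrow> 'a \<Rightarrow> 'a \<Rightarrow> 'a \<Rightarrow> bool" where
  "consecutive C e v e' \<longleftrightarrow> (\<exists>w\<in>C. \<exists>i<length w.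
     e = snd (w ! i) \<and> (v, e') = w ! (Suc i mod length w))"

definition decomposition_corners ::
    "'a multigraph \<Rightarrow> ('a \<times> 'a) list set set \<Rightarrow> 'a set set" where
  "decomposition_corners G \<C> =
     {{e, v, e'} | e v e'. {e, v, e'} \<in> corners G \<and> (\<exists>C\<in>\<C>. consecutive C e v e')}"

definition dart_vertex :: "'a multigraph \<Rightarrow> 'a set \<Rightarrow> 'a" where
  "dart_vertex G d = the_elem (d \<inter> verts G)"

definition dart_edge :: "'a multigraph \<Rightarrow> 'a set \<Rightarrow> 'a" where
  "dart_edge G d = the_elem (d \<inter> edges G)"

definition predecessor :: "'a multigraph \<Rightarrow> 'a set set \<Rightarrow> 'a set \<Rightarrow> 'a set" where
  "predecessor G L d =
     (let e0 = dart_edge G d; v0 = dart_vertex G d;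
          e1 = (THE e1. e1 \<in> edges G \<and> {e0, v0, e1} \<in> L);
          v1 = (THE v1. v1 \<in> ends G e1 \<and> v1 \<noteq> v0)
      in {e1, v1})"

definition period :: "'a multigraph \<Rightarrow> 'a set set \<Rightarrow> 'a set \<Rightarrow> nat" where
  "period G L d = (LEAST k. 0 < k \<and> (predecessor G L ^^ k) d = d)"

text \<open>With \<open>d\<^sub>i = {e\<^sub>i, v\<^sub>i}\<close> the iterated predecessors of \<open>d\<close>, this is the closed walk
  \<open>[v\<^sub>0, e\<^sub>1, v\<^sub>1, \<dots>, v\<^sub>k\<^sub>-\<^sub>1, e\<^sub>k = e\<^sub>0, v\<^sub>k = v\<^sub>0]\<close>, which passes from \<open>e\<^sub>i\<close> to \<open>e\<^sub>i\<^sub>+\<^sub>1\<close>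
  through \<open>v\<^sub>i\<close>.\<close>

definition dart_circuit :: "'a multigraph \<Rightarrow> 'a set set \<Rightarrow> 'a set \<Rightarrow> ('a \<times> 'a) list set" where
  "dart_circuit G L d = unrooted
     (map (\<lambda>i. (dart_vertex G ((predecessor G L ^^ i) d),
                dart_edge G ((predecessor G L ^^ Suc i) d))) [0..<period G L d])"

definition corneration_circuits ::
    "'a multigraph \<Rightarrow> 'a set set \<Rightarrow> ('a \<times> 'a) list set set" where
  "corneration_circuits G L = dart_circuit G L ` darts G"

end

(* On the darts (v, e), let flip exchange the two ends of e, and let mate exchange the two edges
   of the corner of L that contains the dart. Both are involutions without fixed points, and the
   predecessor map is flip o mate. Hence it permutes the darts, and since no orbit of it contains
   a dart together with its flip, the orbit of a dart traverses each edge at most once, as a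
   closed walk all of whose corners lie in L. Conversely, such a walk is recovered, up to rotation
   and reversal, from any of its darts, because L determines the next edge. This yields both the
   disjointness of the circuits of L and the equality for a given circuit decomposition. *)

theory Submission
  imports Defs
begin

section \<open>Walks up to rotation and reversal\<close>

lemma rotations_rotate1: "{rotate n (rotate1 w) | n. True} = {rotate n w | n. True}"
proof (intro equalityI subsetI)
  fix x assume "x \<in> {rotate n (rotate1 w) | n. True}"
  then obtain n where "x = rotate (Suc n) w"
    by (auto simp: rotate1_rotate_swap)
  then show "x \<in> {rotate n w | n. True}" by blast
next
  fix x assume "x \<in> {rotate n w | n. True}"
  then obtain n where n: "x = rotate n w" by blast
  show "x \<in> {rotate n (rotate1 w) | n. True}"
  proof (cases "w = []")
    case True
    then show ?thesis using n by simp
  next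
    case False
    \<comment> \<open>The full length is added to the exponent so that one \<open>rotate1\<close>
      can be split off even when \<open>n = 0\<close>.\<close>
    then have "x = rotate (Suc (n + length w - 1)) w"
      unfolding n by (subst (1 2) rotate_conv_mod) simp
    then have "x = rotate (n + length w - 1) (rotate1 w)"
      by (simp add: rotate1_rotate_swap)
    then show ?thesis by blast
  qed
qed

lemma zip_rotate1:
  "length xs = length ys \<Longrightarrow> zip (rotate1 xs) (rotate1 ys) = rotate1 (zip xs ys)"
  by (cases xs; cases ys) auto

lemma rotate1_rev_rotate1: "rotate1 (rev (rotate1 xs)) = rev xs"
  by (cases xs) auto

lemma length_reverse_walk [simp]: "length (reverse_walk w) = length w"
  by (simp add: reverse_walk_def)

lemma map_snd_reverse_walk [simp]: "map snd (reverse_walk w) = rev (map snd w)"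
  by (simp add: reverse_walk_def)

text \<open>The root stays first while the edges are reversed outright, so vertex and edge indices
  are offset by one. The \<open>mod\<close> takes effect only at \<open>i = 0\<close>.\<close>

lemma reverse_walk_nth:
  assumes "i < length w"
  shows "reverse_walk w ! i =
    (fst (w ! ((length w - i) mod length w)), snd (w ! (length w - Suc i)))"
proof -
  have "Suc (length w - Suc i) = length w - i" using assms by simp
  moreover have "(length w - i) mod length w < length w"
    by (rule mod_less_divisor) (use assms in linarith)
  ultimately show ?thesis
    using assms by (simp add: reverse_walk_def rev_nth nth_rotate1)
qed

lemma reverse_walk_reverse_walk [simp]: "reverse_walk (reverse_walk w) = w"
proof (rule nth_equalityI)
  fix i assume "i < length (reverse_walk (reverse_walk w))"
  then have i: "i < length w" by simp
  let ?j = "(length w - i) mod length w"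
  have "(length w - ?j) mod length w = i"
    using i by (cases "i = 0") auto
  moreover have "?j < length w"
    by (rule mod_less_divisor) (use i in linarith)
  ultimately show "reverse_walk (reverse_walk w) ! i = w ! i"
    using i by (simp add: reverse_walk_nth Suc_diff_Suc prod_eq_iff)
qed simp

text \<open>The dihedral relation: reversal conjugates a rotation into its inverse. It makes the
  reversed half of \<open>unrooted\<close> independent of the root.\<close>

lemma rotate1_reverse_walk_rotate1: "rotate1 (reverse_walk (rotate1 w)) = reverse_walk w"
  by (simp add: reverse_walk_def rotate1_map[symmetric] zip_rotate1[symmetric]
      rotate1_rev_rotate1)

lemma unrooted_rotate1 [simp]: "unrooted (rotate1 w) = unrooted w"
  unfolding unrooted_def rotations_rotate1
  by (subst rotate1_reverse_walk_rotate1[symmetric, of w]) (simp only: rotations_rotate1)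

lemma unrooted_rotate [simp]: "unrooted (rotate n w) = unrooted w"
  by (induction n) simp_all

lemma unrooted_reverse_walk [simp]: "unrooted (reverse_walk w) = unrooted w"
  unfolding unrooted_def by auto

lemma circuit_edges_unrooted [simp]: "circuit_edges (unrooted w) = snd ` set w"
proof -
  have rev: "snd ` set (reverse_walk w) = snd ` set w"
    by (simp only: list.set_map[symmetric] map_snd_reverse_walk set_rev)
  have "snd ` set u = snd ` set w" if u: "u \<in> unrooted w" for u
  proof -
    from u obtain n where "u = rotate n w \<or> u = rotate n (reverse_walk w)"
      unfolding unrooted_def by blast
    then show ?thesis using rev by (elim disjE) (simp_all only: set_rotate)
  qed
  moreover have "w \<in> unrooted w"
    unfolding unrooted_def by (auto intro: exI[of _ 0])
  ultimately show ?thesis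
    unfolding circuit_edges_def set_map by blast
qed

text \<open>The condition in \<open>consecutive\<close> for a single representative. It depends on
  the direction of traversal, which the circuit forgets.\<close>

definition walk_step :: "('a \<times> 'a) list \<Rightarrow> 'a \<Rightarrow> 'a \<Rightarrow> 'a \<Rightarrow> bool" where
  "walk_step w e v e' \<longleftrightarrow>
     (\<exists>i<length w. e = snd (w ! i) \<and> (v, e') = w ! (Suc i mod length w))"

lemma walk_stepI:
  "i < length w \<Longrightarrow>
    walk_step w (snd (w ! i)) (fst (w ! (Suc i mod length w))) (snd (w ! (Suc i mod length w)))"
  unfolding walk_step_def by auto

lemma walk_step_rotateD:
  assumes "walk_step (rotate n w) e v e'"
  shows "walk_step w e v e'"
proof -
  from assms obtain i where i: "i < length w" "e = snd (rotate n w ! i)"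
    "(v, e') = rotate n w ! (Suc i mod length w)"
    by (auto simp: walk_step_def)
  let ?j = "(n + i) mod length w"
  have "0 < length w" using i by linarith
  then have "?j < length w" "e = snd (w ! ?j)" "(v, e') = w ! (Suc ?j mod length w)"
    using i by (simp_all add: nth_rotate mod_simps)
  then show ?thesis unfolding walk_step_def by blast
qed

lemma walk_step_reverseD:
  assumes "walk_step (reverse_walk w) e v e'"
  shows "walk_step w e' v e"
proof -
  let ?k = "length w"
  from assms obtain i where i: "i < ?k" "e = snd (reverse_walk w ! i)"
    "(v, e') = reverse_walk w ! (Suc i mod ?k)"
    by (auto simp: walk_step_def)
  let ?l = "Suc i mod ?k"
  \<comment> \<open>The edge \<open>e'\<close> has position \<open>?l\<close> in the reversed walk
    and hence \<open>?j\<close> in \<open>w\<close>; the edge \<open>e\<close> follows it there, at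
    \<open>?k - Suc i\<close>.\<close>
  let ?j = "?k - Suc ?l"
  have k: "0 < ?k" using i by linarith
  then have l: "?l < ?k" by simp
  have j: "Suc ?j mod ?k = ?k - Suc i"
  proof (cases "Suc i = ?k")
    case True
    then have "?l = 0" by simp
    then have "Suc ?j = ?k" using k by linarith
    then show ?thesis using True by simp
  next
    case False
    then have "Suc i < ?k" using i(1) by linarith
    then have "?l = Suc i" by simp
    then have "Suc ?j = ?k - Suc i" using \<open>Suc i < ?k\<close> by linarith
    then show ?thesis using \<open>Suc i < ?k\<close> by simp
  qed
  have j2: "(?k - ?l) mod ?k = ?k - Suc i"
    using i(1) by (cases "Suc i = ?k") auto
  have "?j < ?k" using k by simp
  moreover have "e' = snd (w ! ?j)"
    using i(3) l by (simp add: reverse_walk_nth)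
  moreover have "(v, e) = w ! (Suc ?j mod ?k)"
    using i(3) l unfolding i(2) j by (simp add: reverse_walk_nth j2 i(1))
  ultimately show ?thesis unfolding walk_step_def by blast
qed

text \<open>Rotating a walk keeps its steps and reversing it swaps their two edges, so one
  representative settles the question for the whole circuit.\<close>

lemma consecutive_unrooted:
  "consecutive (unrooted w) e v e' \<longleftrightarrow> walk_step w e v e' \<or> walk_step w e' v e"
proof
  assume "consecutive (unrooted w) e v e'"
  then obtain u where u: "u \<in> unrooted w" "walk_step u e v e'"
    unfolding consecutive_def walk_step_def by blast
  then show "walk_step w e v e' \<or> walk_step w e' v e"
    unfolding unrooted_def by (auto dest!: walk_step_rotateD walk_step_reverseD)
next
  have mem: "w \<in> unrooted w" "reverse_walk w \<in> unrooted w"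
    unfolding unrooted_def by (auto intro: exI[of _ 0])
  have "walk_step (reverse_walk w) e v e'" if "walk_step w e' v e"
    using that walk_step_reverseD[of "reverse_walk w"] by simp
  moreover assume "walk_step w e v e' \<or> walk_step w e' v e"
  ultimately show "consecutive (unrooted w) e v e'"
    using mem unfolding consecutive_def walk_step_def by blast
qed

lemma closed_walk_reverse:
  assumes "closed_walk G w"
  shows "closed_walk G (reverse_walk w)"
  unfolding closed_walk_def
proof (intro allI impI)
  let ?k = "length w"
  fix i assume "i < length (reverse_walk w)"
  then have i: "i < ?k" by simp
  let ?j = "?k - Suc i"
  have j: "?j < ?k" and k: "0 < ?k" using i by auto
  \<comment> \<open>Edge \<open>i\<close> of the reversed walk is edge \<open>?j\<close> of
    \<open>w\<close> traversed backwards, from vertex \<open>Suc ?j\<close> (modulo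
    \<open>?k\<close>) to vertex \<open>?j\<close>.\<close>
  have "(?k - Suc i mod ?k) mod ?k = ?j" "(?k - i) mod ?k = Suc ?j mod ?k"
    using i by (cases "Suc i = ?k"; auto simp: Suc_diff_Suc)+
  then have "reverse_walk w ! i = (fst (w ! (Suc ?j mod ?k)), snd (w ! ?j))"
    "fst (reverse_walk w ! (Suc i mod ?k)) = fst (w ! ?j)"
    using i k by (simp_all add: reverse_walk_nth)
  moreover have "Suc ?j mod ?k < ?k" using k by simp
  ultimately show "fst (reverse_walk w ! i) \<in> verts G \<and> snd (reverse_walk w ! i) \<in> edges G \<and>
      ends G (snd (reverse_walk w ! i)) =
        {fst (reverse_walk w ! i), fst (reverse_walk w ! (Suc i mod length (reverse_walk w)))}"
    using assms j unfolding closed_walk_def by (simp add: insert_commute)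
qed

section \<open>Circuits and corners of a graph\<close>

locale finite_multigraph =
  fixes G :: "'a multigraph"
  assumes graph: "graph G"
begin

lemma edge_not_vert: "e \<in> edges G \<Longrightarrow> e \<notin> verts G"
  using graph unfolding graph_def by blast

lemma end_vert: "e \<in> edges G \<Longrightarrow> v \<in> ends G e \<Longrightarrow> v \<in> verts G"
  using graph unfolding graph_def by blast

lemma card_ends: "e \<in> edges G \<Longrightarrow> card (ends G e) = 2"
  using graph unfolding graph_def by blast

lemma ends_distinct: "e \<in> edges G \<Longrightarrow> ends G e = {u, v} \<Longrightarrow> u \<noteq> v"
  using card_ends by fastforce

lemma other_end:
  assumes "e \<in> edges G" "v \<in> ends G e"
  obtains u where "ends G e = {v, u}" "u \<noteq> v"
proof -
  obtain x y where "ends G e = {x, y}" "x \<noteq> y"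
    using card_ends[OF assms(1)] by (auto simp: card_2_iff)
  then show ?thesis using assms(2) that by (cases "v = x") auto
qed

section \<open>Recovering vertices and edges from darts and corners\<close>

lemma dart_vertex_insert:
  "e \<in> edges G \<Longrightarrow> v \<in> verts G \<Longrightarrow> dart_vertex G {v, e} = v"
proof -
  assume "e \<in> edges G" "v \<in> verts G"
  then have "{v, e} \<inter> verts G = {v}" using edge_not_vert by auto
  then show ?thesis by (simp add: dart_vertex_def)
qed

lemma dart_edge_insert:
  "e \<in> edges G \<Longrightarrow> v \<in> verts G \<Longrightarrow> dart_edge G {v, e} = e"
proof -
  assume "e \<in> edges G" "v \<in> verts G"
  then have "{v, e} \<inter> edges G = {e}" using edge_not_vert by auto
  then show ?thesis by (simp add: dart_edge_def)
qed

text \<open>A corner is a bare set, possibly presented with other names. Intersecting it with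
  \<open>verts G\<close> and with \<open>edges G\<close>, which are disjoint, recovers its vertex
  and its pair of edges.\<close>

lemma corner_edges:
  assumes "{e, v, e'} \<in> corners G" "e \<in> edges G" "e' \<in> edges G" "v \<in> verts G"
  shows "e \<noteq> e'" "v \<in> ends G e" "v \<in> ends G e'"
proof -
  obtain a x b where c: "{e, v, e'} = {a, x, b}" "a \<in> edges G" "b \<in> edges G" "a \<noteq> b"
    "x \<in> ends G a" "x \<in> ends G b"
    using assms(1) unfolding corners_def by auto
  have x: "x \<in> verts G" using c end_vert by blast
  have "{e, v, e'} \<inter> verts G = {v}" "{a, x, b} \<inter> verts G = {x}"
    using assms(2-) c(2-) x edge_not_vert by auto
  then have "{x} = {v}" using c(1) by metis
  then have "x = v" by simp
  moreover have "{e, v, e'} \<inter> edges G = {e, e'}" "{a, x, b} \<inter> edges G = {a, b}"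
    using assms(2-) c(2-) x edge_not_vert by auto
  then have "{e, e'} = {a, b}" using c(1) by metis
  ultimately show "e \<noteq> e'" "v \<in> ends G e" "v \<in> ends G e'"
    using c by (auto simp: doubleton_eq_iff)
qed

lemma cornerI:
  "e \<in> edges G \<Longrightarrow> e' \<in> edges G \<Longrightarrow> e \<noteq> e' \<Longrightarrow> v \<in> ends G e \<Longrightarrow> v \<in> ends G e' \<Longrightarrow>
    {e, v, e'} \<in> corners G"
  unfolding corners_def by blast

section \<open>Closed walks with distinct edges\<close>

definition edge_simple :: "('a \<times> 'a) list \<Rightarrow> bool" where
  "edge_simple w \<longleftrightarrow> closed_walk G w \<and> w \<noteq> [] \<and> distinct (map snd w)"

lemma circuits_eq: "circuits G = unrooted ` {w. edge_simple w}"
  unfolding circuits_def edge_simple_def by (auto simp: Suc_le_eq)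

lemma edge_simple_reverse: "edge_simple w \<Longrightarrow> edge_simple (reverse_walk w)"
  unfolding edge_simple_def
  by (metis closed_walk_reverse distinct_rev length_0_conv length_reverse_walk
      map_snd_reverse_walk)

lemma edge_simple_nth_snd:
  "edge_simple w \<Longrightarrow> i < length w \<Longrightarrow> j < length w \<Longrightarrow> snd (w ! i) = snd (w ! j) \<Longrightarrow> i = j"
  unfolding edge_simple_def by (metis length_map nth_eq_iff_index_eq nth_map)

lemma edge_simple_nth:
  assumes "edge_simple w" "i < length w"
  shows "snd (w ! i) \<in> edges G"
    "ends G (snd (w ! i)) = {fst (w ! i), fst (w ! (Suc i mod length w))}"
    "fst (w ! i) \<noteq> fst (w ! (Suc i mod length w))"
  using assms ends_distinct unfolding edge_simple_def closed_walk_def by blast+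

text \<open>A walk of length 1 would traverse a loop. The bound ensures that consecutive edges
  differ, as a corner requires.\<close>

lemma edge_simple_length:
  assumes "edge_simple w"
  shows "2 \<le> length w"
proof -
  have "0 < length w" using assms by (simp add: edge_simple_def)
  moreover from this have "length w \<noteq> 1" using edge_simple_nth(3)[OF assms, of 0] by auto
  ultimately show ?thesis by linarith
qed

lemma Suc_mod_neq: "2 \<le> k \<Longrightarrow> i < k \<Longrightarrow> Suc i mod k \<noteq> i"
  by (cases "Suc i = k") auto

lemma walk_step_edges:
  assumes "edge_simple w" "walk_step w e v e'"
  shows "e \<in> snd ` set w" "e' \<in> snd ` set w"
    "e \<in> edges G" "e' \<in> edges G" "e \<noteq> e'" "v \<in> ends G e" "v \<in> ends G e'"
proof -
  from assms(2) obtain i where i: "i < length w" "e = snd (w ! i)"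
    "(v, e') = w ! (Suc i mod length w)"
    unfolding walk_step_def by blast
  let ?j = "Suc i mod length w"
  have e': "e' = snd (w ! ?j)" "v = fst (w ! ?j)" using i(3) by (metis fst_conv snd_conv)+
  have "0 < length w" using i(1) by linarith
  then have j: "?j < length w" by simp
  show "e \<in> snd ` set w" "e' \<in> snd ` set w" using i e' j by auto
  show "e \<in> edges G" "e' \<in> edges G" "v \<in> ends G e" "v \<in> ends G e'"
    using edge_simple_nth[OF assms(1)] i(1,2) e' j by auto
  show "e \<noteq> e'"
    using edge_simple_nth_snd[OF assms(1) i(1) j] edge_simple_length[OF assms(1)]
      Suc_mod_neq[OF _ i(1)] i(2) e' by auto
qed

lemma walk_step_corner:
  "edge_simple w \<Longrightarrow> walk_step w e v e' \<Longrightarrow> {e, v, e'} \<in> corners G"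
  by (rule cornerI) (rule walk_step_edges; assumption)+

text \<open>The walk either leaves \<open>e\<close> through \<open>v\<close> or enters it there, and
  reversal turns the second case into the first. Later arguments may thus assume that
  \<open>e\<close> is left through \<open>v\<close>.\<close>

lemma walk_dart_cases:
  assumes "edge_simple w" "e \<in> snd ` set w" "v \<in> ends G e"
  obtains u i where "u = w \<or> u = reverse_walk w" "i < length u" "e = snd (u ! i)"
    "v = fst (u ! (Suc i mod length u))"
proof -
  obtain i where i: "i < length w" "e = snd (w ! i)"
    using assms(2) by (auto simp: in_set_conv_nth)
  then consider "v = fst (w ! (Suc i mod length w))" | "v = fst (w ! i)"
    using edge_simple_nth(2)[OF assms(1) i(1)] assms(3) by auto
  then show thesis
  proof cases
    case 1
    then show thesis using that[of w i] i by blast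
  next
    case 2
    let ?k = "length w"
    let ?j = "?k - Suc i"
    have "(?k - Suc ?j mod ?k) mod ?k = i" "?j < ?k" "0 < ?k"
      using i(1) by (cases "i = 0"; auto simp: Suc_diff_Suc)+
    moreover from this have "v = fst (reverse_walk w ! (Suc ?j mod ?k))"
      using 2 by (simp add: reverse_walk_nth)
    moreover have "e = snd (reverse_walk w ! ?j)"
      using i by (simp add: reverse_walk_nth Suc_diff_Suc)
    ultimately show thesis using that[of "reverse_walk w" ?j] by simp
  qed
qed

text \<open>As \<open>e\<close> occurs once in \<open>w\<close>, a step out of \<open>e\<close> is
  determined (\<open>fwd\<close>), and so is a step into \<open>e\<close>, by reversal. One step of
  each kind at the same \<open>v\<close> would make both ends of \<open>e\<close> equal to
  \<open>v\<close> (\<open>mixed\<close>).\<close>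

lemma consecutive_unique:
  assumes w: "edge_simple w"
    and "consecutive (unrooted w) e v e1" "consecutive (unrooted w) e v e2"
  shows "e1 = e2"
proof -
  have fwd: "a = b" if u: "edge_simple u" "walk_step u e v a" "walk_step u e v b" for u a b
  proof -
    obtain i j where i: "i < length u" "e = snd (u ! i)" "(v, a) = u ! (Suc i mod length u)"
      and j: "j < length u" "e = snd (u ! j)" "(v, b) = u ! (Suc j mod length u)"
      using u(2,3) unfolding walk_step_def by blast
    have "i = j" using edge_simple_nth_snd[OF u(1) i(1) j(1)] i(2) j(2) by simp
    then show ?thesis using i(3) j(3) by (metis prod.inject)
  qed
  have mixed: False if s: "walk_step w e v a" "walk_step w b v e" for a b
  proof -
    obtain i j where i: "i < length w" "e = snd (w ! i)" "(v, a) = w ! (Suc i mod length w)"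
      and j: "j < length w" "(v, e) = w ! (Suc j mod length w)"
      using s unfolding walk_step_def by blast
    have e: "snd (w ! (Suc j mod length w)) = e" "fst (w ! (Suc j mod length w)) = v"
      using j(2) by (metis fst_conv snd_conv)+
    have "0 < length w" using i(1) by linarith
    then have "Suc j mod length w < length w" by simp
    from edge_simple_nth_snd[OF w this i(1)] have "Suc j mod length w = i"
      using e(1) i(2) by simp
    then have "fst (w ! i) = v" using e by simp
    moreover have "fst (w ! (Suc i mod length w)) = v" using i(3) by (metis fst_conv)
    ultimately show False using edge_simple_nth(3)[OF w i(1)] by simp
  qed
  have rev: "walk_step (reverse_walk w) e v a" if "walk_step w a v e" for a
    using that walk_step_reverseD[of "reverse_walk w"] by simp
  show ?thesis
    using assms(2,3) fwd[OF w] fwd[OF edge_simple_reverse[OF w]] mixed rev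
    unfolding consecutive_unrooted by blast
qed

end

section \<open>The circuits of a corneration\<close>

text \<open>An equality would make \<open>x\<close> a fixed point of an alternating word of odd
  length in \<open>a\<close> and \<open>b\<close>, which is conjugate to \<open>a\<close> or to
  \<open>b\<close>. The induction strips one letter from each end of this word. With
  \<open>flip\<close> and \<open>mate\<close> it shows that no orbit contains a dart together with
  its flip.\<close>

lemma iterated_involutions_neq:
  assumes a: "\<And>x. a (a x) = x" and b: "\<And>x. b (b x) = x"
    and fix_free: "\<And>x. x \<in> D \<Longrightarrow> a x \<noteq> x" "\<And>x. x \<in> D \<Longrightarrow> b x \<noteq> x"
    and closed: "\<And>x. x \<in> D \<Longrightarrow> a (b x) \<in> D"
  shows "x \<in> D \<Longrightarrow> ((\<lambda>x. a (b x)) ^^ m) x \<noteq> a x"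
proof (induction m arbitrary: x rule: induct_nat_012)
  case 0
  then show ?case using fix_free(1)[of x] by auto
next
  case 1
  then show ?case using fix_free(2)[of x] a by (metis One_nat_def funpow_0 funpow.simps(2) comp_apply)
next
  case (ge2 m)
  let ?F = "\<lambda>x. a (b x)"
  show ?case
  proof
    assume "(?F ^^ Suc (Suc m)) x = a x"
    then have "a (b ((?F ^^ m) (?F x))) = a x" using funpow_swap1[of ?F m x] by simp
    then have "(?F ^^ m) (?F x) = b x" using a b by metis
    \<comment> \<open>Since \<open>b x = a (a (b x))\<close>, this is the excluded equality for
      \<open>m\<close>, with the starting point moved to \<open>?F x\<close>.\<close>
    then have "(?F ^^ m) (?F x) = a (?F x)" using a by simp
    then show False using ge2.IH(1)[OF closed[OF ge2.prems]] by blast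
  qed
qed

locale cornered_multigraph = finite_multigraph +
  fixes L :: "'a set set"
  assumes corneration: "corneration G L"
begin

lemma L_corner: "c \<in> L \<Longrightarrow> c \<in> corners G"
  using corneration unfolding corneration_def by blast

lemma L_unique:
  assumes "{e, v, e1} \<in> L" "{e, v, e2} \<in> L" "e \<in> edges G" "v \<in> ends G e"
    "e1 \<in> edges G" "e2 \<in> edges G"
  shows "e1 = e2"
proof -
  have v: "v \<in> verts G" using assms end_vert by blast
  have "{v, e} \<in> darts G" using assms unfolding darts_def by blast
  then have "{e, v, e1} = {e, v, e2}"
    using corneration assms(1,2) unfolding corneration_def by blast
  \<comment> \<open>These inequalities allow \<open>e1\<close> to be cancelled against
    \<open>e2\<close> in the equality of sets.\<close>
  moreover have "e1 \<noteq> e" "e1 \<noteq> v"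
    using corner_edges(1)[OF L_corner[OF assms(1)]] assms v edge_not_vert by auto
  ultimately show ?thesis by auto
qed

lemma L_exists:
  assumes "e \<in> edges G" "v \<in> ends G e"
  obtains e' where "e' \<in> edges G" "{e, v, e'} \<in> L"
proof -
  have v: "v \<in> verts G" using assms end_vert by blast
  have "{v, e} \<in> darts G" using assms unfolding darts_def by blast
  then obtain c where c: "c \<in> L" "{v, e} \<subseteq> c"
    using corneration unfolding corneration_def by blast
  then obtain a x b where abx: "c = {a, x, b}" "a \<in> edges G" "b \<in> edges G" "x \<in> ends G a"
    using L_corner unfolding corners_def by blast
  then have "x \<in> verts G" using end_vert by blast
  then have "x = v" "e = a \<or> e = b"
    using c abx v assms edge_not_vert by auto
  then show ?thesis using that[of a] that[of b] c abx by (auto simp: insert_commute)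
qed

lemma predecessor_eq:
  assumes L: "{e, v, e'} \<in> L" and e: "e \<in> edges G" "e' \<in> edges G" and v: "v \<in> ends G e"
    and v': "ends G e' = {v, v'}"
  shows "predecessor G L {v, e} = {v', e'}"
proof -
  have vv: "v \<in> verts G" using v e end_vert by blast
  have "(THE e1. e1 \<in> edges G \<and> {e, v, e1} \<in> L) = e'"
    using L e v L_unique by blast
  moreover have "(THE v1. v1 \<in> ends G e' \<and> v1 \<noteq> v) = v'"
    using v' ends_distinct[OF e(2) v'] by blast
  ultimately show ?thesis
    unfolding predecessor_def dart_edge_insert[OF e(1) vv] dart_vertex_insert[OF e(1) vv]
    by (simp add: insert_commute)
qed

text \<open>The meeting point of both directions of the theorem: these walks represent exactly the
  circuits of \<open>L\<close>, yet they are described without \<open>predecessor\<close> and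
  \<open>period\<close>.\<close>

definition cornered_walk :: "('a \<times> 'a) list \<Rightarrow> bool" where
  "cornered_walk w \<longleftrightarrow> edge_simple w \<and> (\<forall>e v e'. walk_step w e v e' \<longrightarrow> {e, v, e'} \<in> L)"

lemma cornered_walk_reverse:
  assumes "cornered_walk w"
  shows "cornered_walk (reverse_walk w)"
  unfolding cornered_walk_def
proof (intro conjI allI impI)
  show "edge_simple (reverse_walk w)"
    using assms edge_simple_reverse by (simp add: cornered_walk_def)
  fix e v e' assume "walk_step (reverse_walk w) e v e'"
  then have "{e', v, e} \<in> L"
    using assms walk_step_reverseD[of w e v e'] unfolding cornered_walk_def by simp
  then show "{e, v, e'} \<in> L" by (simp add: insert_commute)
qed

text \<open>Each application of \<open>predecessor\<close> advances one position along
  \<open>w\<close>, because \<open>L\<close> determines the next edge. As the edges are distinct,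
  the dart first recurs after \<open>length w\<close> steps.\<close>

lemma dart_circuit_forward:
  assumes w: "cornered_walk w" and i: "i < length w"
  shows "dart_circuit G L {fst (w ! (Suc i mod length w)), snd (w ! i)} = unrooted w"
proof -
  let ?k = "length w"
  let ?d = "{fst (w ! (Suc i mod ?k)), snd (w ! i)}"
  have s: "edge_simple w" using w by (simp add: cornered_walk_def)
  have k: "0 < ?k" using i by linarith
  note nth = edge_simple_nth[OF s]
  have vert: "fst (w ! l) \<in> verts G" if "l < ?k" for l
    using s that unfolding edge_simple_def closed_walk_def by blast
  \<comment> \<open>The walk read periodically from position \<open>i\<close>, so that the induction
    along the orbit never meets the wrap-around.\<close>
  define x where "x j = w ! ((i + j) mod ?k)" for j
  have x_step: "{snd (x j), fst (x (Suc j)), snd (x (Suc j))} \<in> L" for j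
    using w walk_stepI[of "(i + j) mod ?k" w] k
    unfolding cornered_walk_def x_def by (simp add: mod_simps)
  have x_ends: "snd (x j) \<in> edges G" "ends G (snd (x j)) = {fst (x j), fst (x (Suc j))}" for j
    using nth[of "(i + j) mod ?k"] k by (simp_all add: x_def mod_simps)
  have pow: "(predecessor G L ^^ j) ?d = {fst (x (Suc j)), snd (x j)}" for j
  proof (induction j)
    case 0
    then show ?case using i by (simp add: x_def)
  next
    case (Suc j)
    show ?case
      using predecessor_eq[OF x_step[of j] x_ends(1) x_ends(1) _ x_ends(2)] x_ends(2)
      by (simp add: Suc)
  qed
  have x_vert: "fst (x j) \<in> verts G" for j
    using vert k by (simp add: x_def)
  have dec: "dart_vertex G ((predecessor G L ^^ j) ?d) = fst (x (Suc j))"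
    "dart_edge G ((predecessor G L ^^ j) ?d) = snd (x j)" for j
    unfolding pow using dart_vertex_insert dart_edge_insert x_ends(1) x_vert by blast+
  have period: "period G L ?d = ?k"
    unfolding period_def
  proof (rule Least_equality)
    have "x (?k + j) = x j" for j
      by (simp add: x_def add.left_commute[of i])
    \<comment> \<open>Both equations are needed, since the dart after \<open>j\<close> steps
      combines the edge of \<open>x j\<close> with the vertex of \<open>x (Suc j)\<close>.\<close>
    from this[of 0] this[of 1] have "x ?k = x 0" "x (Suc ?k) = x (Suc 0)" by simp_all
    then have "(predecessor G L ^^ ?k) ?d = (predecessor G L ^^ 0) ?d"
      unfolding pow by (simp only:)
    then show "0 < ?k \<and> (predecessor G L ^^ ?k) ?d = ?d" using k by (simp only: funpow_0)
  next
    fix m assume m: "0 < m \<and> (predecessor G L ^^ m) ?d = ?d"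
    \<comment> \<open>A recurring dart has a recurring edge, and an edge determines its position in
      \<open>w\<close>.\<close>
    then have "snd (x m) = snd (x 0)" using dec(2)[of m] dec(2)[of 0] by (simp only: funpow_0)
    then have "(i + m) mod ?k = (i + 0) mod ?k"
      unfolding x_def by (rule edge_simple_nth_snd[OF s, rotated 2])
        (use k in \<open>auto simp only: mod_less_divisor\<close>)
    then have eq: "(i + m) mod ?k = i" using i by simp
    show "?k \<le> m"
    proof (rule ccontr)
      assume "\<not> ?k \<le> m"
      then show False
        using eq m i by (cases "i + m < ?k") (simp_all add: le_mod_geq)
    qed
  qed
  \<comment> \<open>The list defining the circuit pairs the vertex of dart \<open>j\<close> with the
    edge of dart \<open>Suc j\<close>. This pair is \<open>x (Suc j)\<close>, hence the rotation by
    \<open>Suc i\<close>.\<close>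
  have "map (\<lambda>j. (dart_vertex G ((predecessor G L ^^ j) ?d),
      dart_edge G ((predecessor G L ^^ Suc j) ?d))) [0..<?k] = rotate (Suc i) w"
    unfolding dec by (rule nth_equalityI) (simp_all add: nth_rotate x_def del: rotate_Suc)
  then show ?thesis
    unfolding dart_circuit_def period by simp
qed

text \<open>Either end of \<open>e\<close> gives the same circuit, since the other end only reverses
  the walk. Thus an edge of a cornered walk determines its circuit, which is the source of all
  uniqueness below.\<close>

lemma dart_circuit_eq:
  assumes "cornered_walk w" "e \<in> snd ` set w" "v \<in> ends G e"
  shows "dart_circuit G L {v, e} = unrooted w"
proof -
  have "edge_simple w" using assms(1) by (simp add: cornered_walk_def)
  from walk_dart_cases[OF this assms(2,3)] obtain u i where
    "u = w \<or> u = reverse_walk w" "i < length u" "e = snd (u ! i)"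
    "v = fst (u ! (Suc i mod length u))" .
  then show ?thesis
    using assms(1) cornered_walk_reverse dart_circuit_forward[of u i] by auto
qed

text \<open>Off the set of darts both maps are the identity, so that they are involutions of the
  whole type.\<close>

definition incidences :: "('a \<times> 'a) set" where
  "incidences = {(v, e). e \<in> edges G \<and> v \<in> ends G e}"

definition mate :: "'a \<times> 'a \<Rightarrow> 'a \<times> 'a" where
  "mate p = (if p \<in> incidences
     then (fst p, THE e. e \<in> edges G \<and> {snd p, fst p, e} \<in> L) else p)"

definition flip :: "'a \<times> 'a \<Rightarrow> 'a \<times> 'a" where
  "flip p = (if p \<in> incidences then (THE u. u \<in> ends G (snd p) \<and> u \<noteq> fst p, snd p) else p)"

lemma mate_eq:
  assumes "(v, e) \<in> incidences" "e' \<in> edges G" "{e, v, e'} \<in> L"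
  shows "mate (v, e) = (v, e')"
proof -
  have "(THE e1. e1 \<in> edges G \<and> {e, v, e1} \<in> L) = e'"
    using assms L_unique unfolding incidences_def by blast
  then show ?thesis using assms(1) by (simp add: mate_def)
qed

lemma flip_eq:
  assumes "e \<in> edges G" "ends G e = {v, u}"
  shows "flip (v, e) = (u, e)"
proof -
  have "(THE x. x \<in> ends G e \<and> x \<noteq> v) = u"
    using assms ends_distinct[OF assms] by blast
  then show ?thesis using assms by (simp add: flip_def incidences_def)
qed

lemma mate_cases:
  assumes "(v, e) \<in> incidences"
  obtains e' where "mate (v, e) = (v, e')" "(v, e') \<in> incidences" "e' \<noteq> e" "{e, v, e'} \<in> L"
    "mate (v, e') = (v, e)"
proof -
  have e: "e \<in> edges G" "v \<in> ends G e" using assms by (auto simp: incidences_def)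
  obtain e' where e': "e' \<in> edges G" "{e, v, e'} \<in> L" using L_exists[OF e] .
  have "e \<noteq> e'" "v \<in> ends G e'"
    using corner_edges[OF L_corner[OF e'(2)] e(1) e'(1)] end_vert e by blast+
  moreover have "{e', v, e} \<in> L" using e'(2) by (simp add: insert_commute)
  ultimately show ?thesis
    using that mate_eq[OF assms e'] mate_eq[of v e' e] e e' by (auto simp: incidences_def)
qed

lemma flip_cases:
  assumes "(v, e) \<in> incidences"
  obtains u where "flip (v, e) = (u, e)" "(u, e) \<in> incidences" "u \<noteq> v" "ends G e = {v, u}"
    "flip (u, e) = (v, e)"
proof -
  have e: "e \<in> edges G" "v \<in> ends G e" using assms by (auto simp: incidences_def)
  obtain u where "ends G e = {v, u}" "u \<noteq> v" using other_end[OF e] .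
  then show ?thesis
    using that[of u] flip_eq[of e v u] flip_eq[of e u v] e
    by (auto simp: incidences_def insert_commute)
qed

lemma mate_mate: "mate (mate p) = p"
proof (cases "p \<in> incidences")
  case True
  then show ?thesis by (cases p) (metis mate_cases)
qed (simp add: mate_def)

lemma flip_flip: "flip (flip p) = p"
proof (cases "p \<in> incidences")
  case True
  then show ?thesis by (cases p) (metis flip_cases)
qed (simp add: flip_def)

text \<open>On pairs, \<open>flip o mate\<close> is the predecessor step: \<open>mate\<close> turns
  the corner at \<open>fst p\<close>, then \<open>flip\<close> crosses the new edge to its far
  end.\<close>

lemma flip_mate_cases:
  assumes "p \<in> incidences"
  shows "flip (mate p) \<in> incidences"
    "{snd p, fst p, snd (flip (mate p))} \<in> L"
    "ends G (snd (flip (mate p))) = {fst p, fst (flip (mate p))}"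
proof -
  obtain v e where p: "p = (v, e)" by fastforce
  obtain e' where e': "mate (v, e) = (v, e')" "(v, e') \<in> incidences" "{e, v, e'} \<in> L"
    using mate_cases assms p by metis
  obtain u where "flip (v, e') = (u, e')" "(u, e') \<in> incidences" "ends G e' = {v, u}"
    using flip_cases e'(2) by metis
  then show "flip (mate p) \<in> incidences" "{snd p, fst p, snd (flip (mate p))} \<in> L"
    "ends G (snd (flip (mate p))) = {fst p, fst (flip (mate p))}"
    using e' p by auto
qed

section \<open>Orbits of darts as closed walks\<close>

lemma finite_incidences: "finite incidences"
proof -
  have "incidences \<subseteq> verts G \<times> edges G" using end_vert by (auto simp: incidences_def)
  then show ?thesis
    using graph finite_subset unfolding graph_def by blast
qed

lemma same_edge_flip:
  assumes "p \<in> incidences" "q \<in> incidences" "snd p = snd q"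
  shows "q = p \<or> q = flip p"
proof -
  obtain v e where p: "p = (v, e)" by fastforce
  obtain u where "flip p = (u, e)" "ends G e = {v, u}" using flip_cases assms(1) p by metis
  then show ?thesis using assms p by (cases q) (auto simp: incidences_def)
qed

text \<open>The walk is the orbit of \<open>p\<close> up to its first return. A repeated edge would
  mean a repeated dart, against minimality of the period, or a dart together with its flip, against
  \<open>iterated_involutions_neq\<close>.\<close>

lemma cornered_walk_through:
  assumes p: "p \<in> incidences"
  obtains w where "cornered_walk w" "snd p \<in> snd ` set w"
proof -
  define F where "F = (\<lambda>p. flip (mate p))"
  have inj: "inj F"
  proof (rule injI)
    fix x y assume "F x = F y"
    then have "mate (flip (F x)) = mate (flip (F y))" by simp
    then show "x = y" by (simp add: F_def flip_flip mate_mate)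
  qed
  have pow_add: "(F ^^ (m + n)) x = (F ^^ m) ((F ^^ n) x)" for m n x
    by (simp add: funpow_add)
  have in_inc: "(F ^^ n) q \<in> incidences" if "q \<in> incidences" for n q
    by (induction n) (use that flip_mate_cases(1) in \<open>auto simp: F_def\<close>)
  have "finite {y. \<exists>n. y = (F ^^ n) p}"
    by (rule finite_subset[OF _ finite_incidences]) (use in_inc[OF p] in blast)
  \<comment> \<open>An injective map with a finite orbit returns to its starting point itself, not
    merely to some later point.\<close>
  from funpow_inj_finite[OF inj this] have ex: "\<exists>n. 0 < n \<and> (F ^^ n) p = p" by blast
  define k where "k = (LEAST n. 0 < n \<and> (F ^^ n) p = p)"
  have k: "0 < k" "(F ^^ k) p = p" using LeastI_ex[OF ex] unfolding k_def by blast+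
  have minimal: "k \<le> n" if "0 < n" "(F ^^ n) p = p" for n
    unfolding k_def by (rule Least_le) (use that in blast)
  have periodic: "(F ^^ (n mod k)) p = (F ^^ n) p" for n
    using k(2) by (rule funpow_mod_eq)
  have fst_step: "ends G (snd ((F ^^ Suc i) p)) = {fst ((F ^^ i) p), fst ((F ^^ Suc i) p)}"
    and L_step: "{snd ((F ^^ i) p), fst ((F ^^ i) p), snd ((F ^^ Suc i) p)} \<in> L" for i
    using flip_mate_cases(2,3)[OF in_inc[OF p, of i]] by (simp_all add: F_def)
  have neq: "snd ((F ^^ Suc i) p) \<noteq> snd ((F ^^ Suc j) p)" if "i < j" "j < k" for i j
  proof
    define q where "q = (F ^^ Suc i) p"
    have q: "q \<in> incidences" unfolding q_def by (rule in_inc[OF p])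
    have "Suc j = (j - i) + Suc i" using that(1) by simp
    then have jq: "(F ^^ Suc j) p = (F ^^ (j - i)) q"
      unfolding q_def by (simp only: pow_add)
    assume "snd ((F ^^ Suc i) p) = snd ((F ^^ Suc j) p)"
    then consider "(F ^^ (j - i)) q = q" | "(F ^^ (j - i)) q = flip q"
      using same_edge_flip[OF q in_inc[OF q, of "j - i"]] unfolding jq q_def[symmetric] by blast
    then show False
    proof cases
      case 1
      \<comment> \<open>Commuting the two powers lets the injective \<open>F ^^ Suc i\<close> be
        cancelled, which moves the return from \<open>q\<close> back to \<open>p\<close>.\<close>
      have "(F ^^ Suc i) ((F ^^ (j - i)) p) = (F ^^ (j - i)) q"
        unfolding q_def by (simp only: pow_add[symmetric] add.commute)
      then have "(F ^^ Suc i) ((F ^^ (j - i)) p) = (F ^^ Suc i) p"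
        using 1 q_def by simp
      moreover have "inj (F ^^ Suc i)" using inj by (rule inj_fn)
      ultimately have "(F ^^ (j - i)) p = p" by (meson injD)
      then show False using minimal[of "j - i"] that by simp
    next
      case 2
      have "(F ^^ (j - i)) q \<noteq> flip q"
        unfolding F_def
      proof (rule iterated_involutions_neq[where D = incidences])
        show "flip x \<noteq> x" if "x \<in> incidences" for x
          using that flip_cases by (cases x) (metis prod.inject)
        show "mate x \<noteq> x" if "x \<in> incidences" for x
          using that mate_cases by (cases x) (metis prod.inject)
      qed (use flip_flip mate_mate flip_mate_cases(1) q in auto)
      then show False using 2 by blast
    qed
  qed
  \<comment> \<open>The shift by one is the one in \<open>dart_circuit\<close>: edge
    \<open>i\<close> of \<open>w\<close> is that of dart \<open>Suc i\<close>, which joins the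
    vertices of darts \<open>i\<close> and \<open>Suc i\<close>.\<close>
  define w where "w = map (\<lambda>i. (fst ((F ^^ i) p), snd ((F ^^ Suc i) p))) [0..<k]"
  have len: "length w = k" by (simp add: w_def)
  have w_nth: "w ! i = (fst ((F ^^ i) p), snd ((F ^^ Suc i) p))" if "i < k" for i
    using that by (simp add: w_def)
  have w_Suc: "w ! (Suc i mod k) = (fst ((F ^^ Suc i) p), snd ((F ^^ Suc (Suc i)) p))" for i
  proof -
    \<comment> \<open>One \<open>F\<close> is pulled out so that the remaining exponent is a residue
      modulo \<open>k\<close>, to which periodicity applies.\<close>
    have "(F ^^ Suc (Suc i mod k)) p = F ((F ^^ (Suc i mod k)) p)" by simp
    then have "(F ^^ Suc (Suc i mod k)) p = (F ^^ Suc (Suc i)) p" unfolding periodic by simp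
    then show ?thesis using w_nth[of "Suc i mod k"] k(1) periodic[of "Suc i"] by simp
  qed
  have inc: "snd ((F ^^ i) p) \<in> edges G" "fst ((F ^^ i) p) \<in> verts G" for i
    using in_inc[OF p, of i] end_vert unfolding incidences_def by auto
  have "closed_walk G w"
    unfolding closed_walk_def len using w_nth w_Suc inc fst_step by (simp del: funpow.simps)
  moreover have "distinct (map snd w)"
    unfolding distinct_conv_nth
  proof (intro allI impI)
    fix i j assume "i < length (map snd w)" "j < length (map snd w)" "i \<noteq> j"
    then have "i < j \<and> j < k \<or> j < i \<and> i < k"
      and "map snd w ! i = snd ((F ^^ Suc i) p)" "map snd w ! j = snd ((F ^^ Suc j) p)"
      using len w_nth by auto
    then show "map snd w ! i \<noteq> map snd w ! j"
      using neq[of i j] neq[of j i] by (elim disjE) (simp_all only:, simp_all)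
  qed
  moreover have "w \<noteq> []" using len k(1) by auto
  moreover have "{e, v, e'} \<in> L" if "walk_step w e v e'" for e v e'
    using that L_step w_nth w_Suc unfolding walk_step_def len by (auto simp del: funpow.simps)
  ultimately have "cornered_walk w" by (simp add: cornered_walk_def edge_simple_def)
  \<comment> \<open>Because of the shift, the edge of \<open>p\<close> comes last in
    \<open>w\<close>, as the edge of dart \<open>k\<close>, which is \<open>p\<close> again.\<close>
  moreover have "snd p = snd (w ! (k - 1))" using w_nth[of "k - 1"] k by simp
  then have "snd p \<in> snd ` set w" using len k(1) by (metis diff_less imageI nth_mem zero_less_one)
  ultimately show ?thesis using that by blast
qed

section \<open>The circuits of a corneration decompose the edges\<close>

lemma corneration_circuitsE:
  assumes "C \<in> corneration_circuits G L"
  obtains w where "cornered_walk w" "C = unrooted w"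
proof -
  obtain v e where d: "C = dart_circuit G L {v, e}" "e \<in> edges G" "v \<in> ends G e"
    using assms unfolding corneration_circuits_def darts_def by blast
  obtain w where "cornered_walk w" "e \<in> snd ` set w"
    using cornered_walk_through[of "(v, e)"] d by (auto simp: incidences_def)
  then show ?thesis using that[of w] dart_circuit_eq[of w e v] d by simp
qed

text \<open>For each edge one end \<open>v\<close> is fixed. Any circuit of \<open>L\<close> through
  the edge is represented by a cornered walk, so \<open>dart_circuit_eq\<close> identifies it with
  the circuit of the dart at \<open>v\<close>.\<close>

lemma circuit_decomposition_corneration_circuits:
  "circuit_decomposition G (corneration_circuits G L)"
  unfolding circuit_decomposition_def
proof (intro conjI ballI)
  show "corneration_circuits G L \<subseteq> circuits G"
  proof
    fix C assume "C \<in> corneration_circuits G L"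
    then obtain w where "cornered_walk w" "C = unrooted w" by (rule corneration_circuitsE)
    then show "C \<in> circuits G" by (simp add: circuits_eq cornered_walk_def)
  qed
next
  fix e assume e: "e \<in> edges G"
  have "ends G e \<noteq> {}" using card_ends[OF e] by auto
  then obtain v where v: "v \<in> ends G e" by blast
  have d: "{v, e} \<in> darts G" using e v unfolding darts_def by blast
  obtain w where w: "cornered_walk w" "e \<in> snd ` set w"
    using cornered_walk_through[of "(v, e)"] e v by (auto simp: incidences_def)
  show "\<exists>!C. C \<in> corneration_circuits G L \<and> e \<in> circuit_edges C"
  proof (rule ex1I)
    have "dart_circuit G L {v, e} \<in> corneration_circuits G L"
      unfolding corneration_circuits_def using d by (rule imageI)
    then show "dart_circuit G L {v, e} \<in> corneration_circuits G L \<and>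
        e \<in> circuit_edges (dart_circuit G L {v, e})"
      using dart_circuit_eq[OF w v] w(2) by simp
  next
    fix C assume C: "C \<in> corneration_circuits G L \<and> e \<in> circuit_edges C"
    then obtain u where u: "cornered_walk u" "C = unrooted u"
      by (auto elim: corneration_circuitsE)
    then show "C = dart_circuit G L {v, e}" using dart_circuit_eq[OF u(1) _ v] C by simp
  qed
qed

end

section \<open>The corneration of a circuit decomposition\<close>

context finite_multigraph
begin

lemma decomposition_circuit:
  assumes "circuit_decomposition G \<C>" "C \<in> \<C>"
  obtains w where "edge_simple w" "C = unrooted w"
proof -
  have "C \<in> unrooted ` {w. edge_simple w}"
    using assms unfolding circuit_decomposition_def circuits_eq by (elim conjE) (rule subsetD)
  then show ?thesis using that by (elim imageE) simp
qed

lemma decomposition_walk: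
  assumes "circuit_decomposition G \<C>" "e \<in> edges G"
  obtains w where "edge_simple w" "unrooted w \<in> \<C>" "e \<in> snd ` set w"
    "\<forall>C\<in>\<C>. e \<in> circuit_edges C \<longrightarrow> C = unrooted w"
proof -
  have "\<exists>!C. C \<in> \<C> \<and> e \<in> circuit_edges C"
    using assms by (simp add: circuit_decomposition_def)
  then obtain C where C: "C \<in> \<C>" "e \<in> circuit_edges C"
    "\<forall>D\<in>\<C>. e \<in> circuit_edges D \<longrightarrow> D = C"
    by (elim ex1E) blast
  obtain w where w: "edge_simple w" "C = unrooted w"
    using decomposition_circuit[OF assms(1) C(1)] .
  then show ?thesis
    using C(1,2) by (intro that[OF w(1) _ _ C(3)[unfolded w(2)]]) simp_all
qed

text \<open>A corner is symmetric in its two edges, so they can be named in the order in which the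
  chosen walk traverses them.\<close>

lemma decomposition_cornersE:
  assumes "circuit_decomposition G \<C>" "c \<in> decomposition_corners G \<C>"
  obtains w e v e' where "edge_simple w" "unrooted w \<in> \<C>" "c = {e, v, e'}"
    "walk_step w e v e'"
proof -
  obtain e v e' C where c: "c = {e, v, e'}" "C \<in> \<C>" "consecutive C e v e'"
    using assms(2) unfolding decomposition_corners_def by blast
  obtain w where w: "edge_simple w" "C = unrooted w"
    using decomposition_circuit[OF assms(1) c(2)] .
  have "{e, v, e'} = {e', v, e}" by auto
  moreover have "walk_step w e v e' \<or> walk_step w e' v e"
    using c(3) unfolding w(2) consecutive_unrooted .
  ultimately show ?thesis
    using that[of w e v e'] that[of w e' v e] w c(1,2) by metis
qed

lemma decomposition_cornersI:
  assumes "edge_simple w" "unrooted w \<in> \<C>" "walk_step w e v e'"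
  shows "{e, v, e'} \<in> decomposition_corners G \<C>"
proof -
  have "consecutive (unrooted w) e v e'" using assms(3) by (simp add: consecutive_unrooted)
  with assms(2) walk_step_corner[OF assms(1,3)] show ?thesis
    unfolding decomposition_corners_def by blast
qed

text \<open>The circuit through the edge of a dart supplies a corner there. Any competing corner
  comes from a circuit through the same edge, hence from the same circuit, and
  \<open>consecutive_unique\<close> applies.\<close>

lemma corneration_decomposition_corners:
  assumes dec: "circuit_decomposition G \<C>"
  shows "corneration G (decomposition_corners G \<C>)"
  unfolding corneration_def
proof (intro conjI ballI)
  show "decomposition_corners G \<C> \<subseteq> corners G"
    unfolding decomposition_corners_def by blast
next
  fix d assume "d \<in> darts G"
  then obtain v e where d: "d = {v, e}" "e \<in> edges G" "v \<in> ends G e"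
    unfolding darts_def by blast
  obtain w where w: "edge_simple w" "unrooted w \<in> \<C>" "e \<in> snd ` set w"
    and only: "\<forall>C\<in>\<C>. e \<in> circuit_edges C \<longrightarrow> C = unrooted w"
    using decomposition_walk[OF dec d(2)] .
  obtain u i where u: "u = w \<or> u = reverse_walk w" "i < length u" "e = snd (u ! i)"
    "v = fst (u ! (Suc i mod length u))"
    using walk_dart_cases[OF w(1,3) d(3)] .
  have us: "edge_simple u" "unrooted u = unrooted w" using u(1) w edge_simple_reverse by auto
  define f where "f = snd (u ! (Suc i mod length u))"
  have f: "walk_step u e v f"
    unfolding f_def u(3,4) by (rule walk_stepI[OF u(2)])
  show "\<exists>!c. c \<in> decomposition_corners G \<C> \<and> d \<subseteq> c"
  proof (rule ex1I)
    show "{e, v, f} \<in> decomposition_corners G \<C> \<and> d \<subseteq> {e, v, f}"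
      using decomposition_cornersI[OF us(1) _ f] us w d by auto
  next
    fix c assume c: "c \<in> decomposition_corners G \<C> \<and> d \<subseteq> c"
    then have "c \<in> decomposition_corners G \<C>" ..
    then obtain x a y b where x: "edge_simple x" "unrooted x \<in> \<C>" "c = {a, y, b}"
      "walk_step x a y b"
      by (rule decomposition_cornersE[OF dec])
    note ab = walk_step_edges[OF x(1,4)]
    have "y \<in> verts G" "v \<in> verts G" using end_vert ab(3,6) d(2,3) by simp_all
    moreover have "v \<in> {a, y, b}" "e \<in> {a, y, b}" using c d(1) x(3) by simp_all
    \<comment> \<open>Vertices are never edges, so \<open>v\<close> can only be the middle entry of
      the corner and \<open>e\<close> only an outer one.\<close>
    ultimately have y: "y = v" and e: "e = a \<or> e = b"
      using ab(3,4) d(2) edge_not_vert by auto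
    have "e \<in> circuit_edges (unrooted x)" using e ab(1,2) by auto
    then have x_w: "unrooted x = unrooted w" by (rule only[rule_format, OF x(2)])
    have ab_w: "consecutive (unrooted w) a v b" "consecutive (unrooted w) b v a"
      using x(4) unfolding x_w[symmetric] y consecutive_unrooted by simp_all
    have "consecutive (unrooted w) e v f"
      using f unfolding us(2)[symmetric] consecutive_unrooted by simp
    then have "e = a \<and> b = f \<or> e = b \<and> a = f"
      using e ab_w consecutive_unique[OF w(1), of e v f] by metis
    then show "c = {e, v, f}" using x(3) y by auto
  qed
qed

text \<open>Representatives of the given circuits are cornered walks for their own corners. Hence
  \<open>dart_circuit_eq\<close> rebuilds each circuit from any of its darts, and each dart lies on
  some circuit.\<close>

lemma corneration_circuits_decomposition_corners:
  assumes dec: "circuit_decomposition G \<C>"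
  shows "corneration_circuits G (decomposition_corners G \<C>) = \<C>"
proof -
  let ?L = "decomposition_corners G \<C>"
  interpret cornered_multigraph G ?L
    by unfold_locales (rule corneration_decomposition_corners[OF dec])
  have cw: "cornered_walk w" if "edge_simple w" "unrooted w \<in> \<C>" for w
    using that decomposition_cornersI[OF that] by (simp add: cornered_walk_def)
  show ?thesis
  proof (intro equalityI subsetI)
    fix C assume "C \<in> corneration_circuits G ?L"
    then obtain v e where C: "C = dart_circuit G ?L {v, e}" "e \<in> edges G" "v \<in> ends G e"
      unfolding corneration_circuits_def darts_def by blast
    obtain w where w: "edge_simple w" "unrooted w \<in> \<C>" "e \<in> snd ` set w"
      by (rule decomposition_walk[OF dec C(2)])
    then show "C \<in> \<C>" using C(1,3) dart_circuit_eq[OF cw[OF w(1,2)] w(3)] by simp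
  next
    fix C assume C: "C \<in> \<C>"
    then obtain w where w: "edge_simple w" "C = unrooted w"
      by (rule decomposition_circuit[OF dec])
    have "0 < length w" using w(1) by (simp add: edge_simple_def)
    \<comment> \<open>Any dart on the walk would serve; the first one exists because
      \<open>w\<close> is nonempty.\<close>
    then have e: "snd (w ! 0) \<in> snd ` set w" "snd (w ! 0) \<in> edges G"
      "fst (w ! 0) \<in> ends G (snd (w ! 0))"
      using edge_simple_nth[OF w(1)] by auto
    have "cornered_walk w" using cw[OF w(1)] C w(2) by simp
    then have "C = dart_circuit G ?L {fst (w ! 0), snd (w ! 0)}"
      using dart_circuit_eq[OF _ e(1,3)] w(2) by simp
    moreover have "{fst (w ! 0), snd (w ! 0)} \<in> darts G"
      using e(2,3) unfolding darts_def by blast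
    ultimately show "C \<in> corneration_circuits G ?L"
      unfolding corneration_circuits_def by (rule image_eqI)
  qed
qed

end

theorem theorem4p1:
  fixes G :: "'a multigraph"
  assumes "graph G"
  shows "(\<forall>L. corneration G L \<longrightarrow> circuit_decomposition G (corneration_circuits G L)) \<and>
         (\<forall>\<C>. circuit_decomposition G \<C> \<longrightarrow>
            corneration G (decomposition_corners G \<C>) \<and>
            \<C> = corneration_circuits G (decomposition_corners G \<C>))"
proof -
  interpret finite_multigraph G by unfold_locales (rule assms)
  have "circuit_decomposition G (corneration_circuits G L)" if "corneration G L" for L
  proof -
    interpret cornered_multigraph G L by unfold_locales (rule that)
    show ?thesis by (rule circuit_decomposition_corneration_circuits)
  qed
  then show ?thesis
    using corneration_decomposition_corners corneration_circuits_decomposition_corners by metis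
qed

end
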